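(* There exists a real symmetric tensor $T \in \mathrm{Sym}^3(\mathbb{R}^{27})$ for which $\mathcal{I}_4(T) < 0$, where $\frac{1}{N}\mathcal{I}_k(T)$ (here with $p=3$, $N = 27$) denotes the coefficient of $z^{-k-1}$ in the formal Laurent series expansion of Gurau's resolvent trace $R_T(z)$. Thus, in particular, for this $T$ there exists no probability measure $\gamma_T$ on $\mathbb{R}$ satisfying $$\int x^k \, d\gamma_T(x) = \frac{1}{27}\, \mathcal{I}_k(T) \quad \text{for each integer } k \geq 0.$$
   Context: For integers $p, N \geq 1$, $\mathrm{Sym}^p(\mathbb{R}^N)$ is the set of real symmetric $p$-ary tensors $T = (T_{i_1,\dots,i_p})_{i_1,\dots,i_p \in [N]}$, i.e. with entries invariant under permutation of the indices. Write $\langle T, g^{\otimes p}\rangle = \sum_{i_1,\dots,i_p \in [N]} T_{i_1,\dots,i_p} g_{i_1}\cdots g_{i_p}$ for $g \in \mathbb{R}^N$, and let $\mathcal{N}(0,I_N)$ be the standard Gaussian law on $\mathbb{R}^N$. Gurau's resolvent trace of $T \in \mathrm{Sym}^p(\mathbb{R}^N)$ is $$R_T(z) = \frac{1}{z\, Z_T(z)} \, \mathbf{E}_{g \sim \mathcal{N}(0,I_N)}\left[ \frac{\|g\|^2}{N} \exp\left(\frac{1}{pz}\langle T, g^{\otimes p}\rangle\right)\right], \qquad Z_T(z) = \mathbf{E}_{g \sim \mathcal{N}(0,I_N)} \exp\left(\frac{1}{pz}\langle T, g^{\otimes p}\rangle\right),$$ with the expectations well-defined for nonzero purely imaginary $z$.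 The numbers $\mathcal{I}_k(T)$, $k \geq 0$, are defined by the formal Laurent series expansion $$R_T(z) = \sum_{k \geq 0} z^{-k-1}\, \frac{1}{N}\, \mathcal{I}_k(T),$$ understood as an identity of formal power series in $1/z$: one expands each exponential above as a power series in $1/z$, takes the Gaussian expectation coefficient by coefficient, i.e. $Z_T(z) = \sum_{j\ge 0} \frac{1}{j!\,p^j}\mathbf{E}[\langle T,g^{\otimes p}\rangle^j]\, z^{-j}$ and similarly $\sum_{j \ge 0} \frac{1}{j!\,p^j}\mathbf{E}\big[\frac{\|g\|^2}{N}\langle T,g^{\otimes p}\rangle^j\big] z^{-j}$ for the other expectation, and forms the quotient of formal power series (the constant term of $Z_T$ is $1$). Each $\mathcal{I}_k(T)$ is a homogeneous polynomial of degree $k$ in the entries of $T$, and $\mathcal{I}_0(T) = N$. *)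

theory Defs
  imports "HOL-Probability.Probability" "HOL-Computational_Algebra.Formal_Power_Series"
begin

text \<open>
  A \<open>p\<close>-ary tensor over \<open>\<real>\<^sup>N\<close> is a real function on multi-indices, i.e. lists of length \<open>p\<close> over
  \<open>{..<N}\<close> (indices are counted from 0), and a vector of \<open>\<real>\<^sup>N\<close> is a function on \<open>{..<N}\<close>.
\<close>

definition multi_indices :: "nat \<Rightarrow> nat \<Rightarrow> nat list set" where
  "multi_indices p N = {is. length is = p \<and> set is \<subseteq> {..<N}}"

text \<open>Lists have equal multisets iff one is a permutation of the other.\<close>

definition sym_tensors :: "nat \<Rightarrow> nat \<Rightarrow> (nat list \<Rightarrow> real) set" where
  "sym_tensors p N =
    {T \<in> multi_indices p N \<rightarrow>\<^sub>E UNIV.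
       \<forall>is \<in> multi_indices p N. \<forall>js \<in> multi_indices p N. mset is = mset js \<longrightarrow> T is = T js}"

definition tensor_form :: "nat \<Rightarrow> nat \<Rightarrow> (nat list \<Rightarrow> real) \<Rightarrow> (nat \<Rightarrow> real) \<Rightarrow> real" where
  "tensor_form p N T g = (\<Sum>is\<in>multi_indices p N. T is * (\<Prod>j<p. g (is ! j)))"

definition std_gaussian :: "nat \<Rightarrow> (nat \<Rightarrow> real) measure" where
  "std_gaussian N = (\<Pi>\<^sub>M i\<in>{..<N}. std_normal_distribution)"

text \<open>
  The series below are formal power series in the variable \<open>w = 1/z\<close>. The first two are the
  coefficientwise Gaussian expectations of the power series expansion of
  \<open>exp (w/p * tensor_form p N T g)\<close>, without and with the weight \<open>\<parallel>g\<parallel>\<^sup>2 / N\<close>.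
\<close>

definition gurau_Z :: "nat \<Rightarrow> nat \<Rightarrow> (nat list \<Rightarrow> real) \<Rightarrow> real fps" where
  "gurau_Z p N T = Abs_fps (\<lambda>j.
     1 / (fact j * real p ^ j) * (LINT g|std_gaussian N. tensor_form p N T g ^ j))"

definition gurau_numerator :: "nat \<Rightarrow> nat \<Rightarrow> (nat list \<Rightarrow> real) \<Rightarrow> real fps" where
  "gurau_numerator p N T = Abs_fps (\<lambda>j.
     1 / (fact j * real p ^ j) *
       (LINT g|std_gaussian N. (\<Sum>i<N. (g i)\<^sup>2) / real N * tensor_form p N T g ^ j))"

text \<open>The factor \<open>fps_X\<close> is the prefactor \<open>1/z\<close>.\<close>

definition gurau_resolvent :: "nat \<Rightarrow> nat \<Rightarrow> (nat list \<Rightarrow> real) \<Rightarrow> real fps" where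
  "gurau_resolvent p N T = fps_X * (gurau_numerator p N T / gurau_Z p N T)"

definition gurau_I :: "nat \<Rightarrow> nat \<Rightarrow> nat \<Rightarrow> (nat list \<Rightarrow> real) \<Rightarrow> real" where
  "gurau_I p N k T = real N * fps_nth (gurau_resolvent p N T) (k + 1)"

end

theory Submission
  imports Defs
begin

text \<open>
  Since \<open>I\<^sub>4(T) = 12 [w\<^sup>4] ln Z\<close> for cubic \<open>T\<close> (Gaussian integration by parts), it is a positive multiple of
  the fourth cumulant of the random variable \<open>f = \<langle>T, g\<^sup>\<otimes>\<^sup>3\<rangle>\<close>. For trace-free \<open>T\<close> this cumulant is
  nonnegative, so \<open>f\<close> needs a linear Hermite component. With \<open>x = g\<^sub>0\<close> and \<open>s\<close> the sum of the squares
  of the other \<open>n\<close> coordinates, consider \<open>f = x (p x\<^sup>2 + q s)\<close>. For large \<open>n\<close> the part \<open>q x s\<close> is nearly the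
  Gaussian \<open>q n x\<close>; a negative \<open>p\<close> lightens the tails of \<open>f\<close>, which outweighs the positive
  cumulant caused by the fluctuations of \<open>s\<close> as soon as \<open>n \<ge> 26\<close> for the ratio \<open>p / q = - 5 / 2\<close>.
  As \<open>x\<close> and \<open>s\<close> are independent with explicit moments, the coefficients needed for \<open>n = 26\<close>,
  \<open>p = - 15\<close>, \<open>q = 6\<close> can be evaluated exactly.
\<close>

section \<open>Integrals of products over independent coordinates\<close>

lemma has_bochner_integral_pair_mult:
  fixes f :: "'a \<Rightarrow> real" and g :: "'b \<Rightarrow> real"
  assumes "sigma_finite_measure M1" "sigma_finite_measure M2"
    and f: "has_bochner_integral M1 f a" and g: "has_bochner_integral M2 g b"
  shows "has_bochner_integral (M1 \<Otimes>\<^sub>M M2) (\<lambda>(x, y). f x * g y) (a * b)"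
proof -
  interpret pair_sigma_finite M1 M2
    using assms by (simp add: pair_sigma_finite_def)
  have [measurable]: "f \<in> borel_measurable M1" "g \<in> borel_measurable M2"
    using f g by (auto simp: has_bochner_integral_iff)
  have int: "integrable (M1 \<Otimes>\<^sub>M M2) (\<lambda>(x, y). f x * g y)"
    using f g by (intro Fubini_integrable) (auto simp: has_bochner_integral_iff abs_mult)
  then show ?thesis
    using f g integral_fst'[OF int] by (simp add: has_bochner_integral_iff)
qed

text \<open>Overwriting coordinate \<open>i\<close> with an independent sample pushes the pair
  measure forward to the product over \<open>insert i I\<close>. As \<open>G\<close> ignores
  coordinate \<open>i\<close> by \<open>indep\<close>, the integrand already factors on the pair,
  where Fubini applies.\<close>

lemma has_bochner_integral_PiM_insert_mult:
  fixes f :: "'a \<Rightarrow> real" and G :: "('i \<Rightarrow> 'a) \<Rightarrow> real"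
  assumes M: "\<And>j. prob_space (M j)"
    and f: "has_bochner_integral (M i) f a" and G: "has_bochner_integral (Pi\<^sub>M I M) G b"
    and indep: "\<And>X y. G (X(i := y)) = G X"
    and meas: "G \<in> borel_measurable (Pi\<^sub>M (insert i I) M)"
  shows "has_bochner_integral (Pi\<^sub>M (insert i I) M) (\<lambda>X. f (X i) * G X) (a * b)"
proof -
  have [measurable]: "f \<in> borel_measurable (M i)"
    using f by (auto simp: has_bochner_integral_iff)
  note meas[measurable]
  have "has_bochner_integral (M i \<Otimes>\<^sub>M Pi\<^sub>M I M) (\<lambda>(x, X). f x * G X) (a * b)"
    using f G M by (intro has_bochner_integral_pair_mult prob_space_imp_sigma_finite prob_space_PiM)
  then have "has_bochner_integral
      (distr (M i \<Otimes>\<^sub>M Pi\<^sub>M I M) (Pi\<^sub>M (insert i I) M) (\<lambda>(x, X). X(i := x)))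
      (\<lambda>X. f (X i) * G X) (a * b)"
    by (intro has_bochner_integral_distr) (auto simp: case_prod_unfold indep)
  then show ?thesis
    using distr_pair_PiM_eq_PiM[of I M i] M by simp
qed

section \<open>Moments of the normal and chi-square laws\<close>

text \<open>For even n = 2m this is the double factorial (2m-1)!!. The rising factorial of 1/2 gives
  it the shape of the chi-square moments with one degree of freedom.\<close>

definition gaussian_moment :: "nat \<Rightarrow> real" where
  "gaussian_moment n = (if even n then 2 ^ (n div 2) * pochhammer (1 / 2) (n div 2) else 0)"

lemma prob_space_std_normal: "prob_space std_normal_distribution"
  by (intro prob_space_normal_density) simp

lemma has_bochner_integral_std_normal_power:
  "has_bochner_integral std_normal_distribution (\<lambda>x. x ^ n) (gaussian_moment n)"
proof -
  have "has_bochner_integral lborel (\<lambda>x. std_normal_density x * x ^ n) (gaussian_moment n)"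
  proof (cases "even n")
    case True
    then obtain k where n: "n = 2 * k" by blast
    have "gaussian_moment n = fact (2 * k) / (2 ^ k * fact k)"
      by (simp add: gaussian_moment_def n fact_double power_even_eq power2_eq_square)
    then show ?thesis
      using std_normal_moment_even[of k] n by simp
  next
    case False
    then show ?thesis
      using std_normal_moment_odd by (auto simp: gaussian_moment_def elim!: oddE)
  qed
  then show ?thesis
    by (intro has_bochner_integral_density) auto
qed

text \<open>These are the moments of the chi-square law with \<open>card I\<close> degrees of
  freedom. Splitting off one independent coordinate by the binomial theorem adds 1/2 to the argument
  of \<open>pochhammer\<close>, and the resulting convolution is Vandermonde's identity for rising
  factorials, \<open>pochhammer_binomial_sum\<close>.\<close>

lemma has_bochner_integral_gaussian_sumsq_power:
  assumes "finite I"
  shows "has_bochner_integral (\<Pi>\<^sub>M i\<in>I. std_normal_distribution) (\<lambda>g. (\<Sum>i\<in>I. (g i)\<^sup>2) ^ k)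
    (2 ^ k * pochhammer (real (card I) / 2) k)"
  using assms
proof (induction I arbitrary: k rule: finite_induct)
  case empty
  interpret prob_space "\<Pi>\<^sub>M i\<in>{}. std_normal_distribution"
    by (intro prob_space_PiM prob_space_std_normal)
  show ?case
    by (cases k) (auto simp: has_bochner_integral_iff prob_space pochhammer_0_left)
next
  case (insert i I)
  let ?S = "\<lambda>g. \<Sum>j\<in>I. (g j)\<^sup>2 :: real"
  have upd: "?S (X(i := y)) = ?S X" for X y
    using insert.hyps by (intro sum.cong refl) auto
  have "has_bochner_integral (\<Pi>\<^sub>M i\<in>insert i I. std_normal_distribution)
      (\<lambda>g. \<Sum>l\<le>k. real (k choose l) * (g i ^ (2 * l) * ?S g ^ (k - l)))
      (\<Sum>l\<le>k. real (k choose l) * (gaussian_moment (2 * l) *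
        (2 ^ (k - l) * pochhammer (real (card I) / 2) (k - l))))"
    by (intro has_bochner_integral_sum has_bochner_integral_mult_right
        has_bochner_integral_PiM_insert_mult[where f = "\<lambda>x. x ^ _"] prob_space_std_normal
        has_bochner_integral_std_normal_power insert.IH)
       (auto simp: upd simp del: fun_upd_apply intro!: borel_measurable_power borel_measurable_sum
          measurable_compose[OF measurable_component_singleton])
  moreover have "(\<Sum>l\<le>k. real (k choose l) * (g i ^ (2 * l) * ?S g ^ (k - l))) =
      (\<Sum>j\<in>insert i I. (g j)\<^sup>2) ^ k" for g :: "'a \<Rightarrow> real"
    using insert.hyps by (simp add: binomial_ring power_mult mult.assoc)
  moreover have "(\<Sum>l\<le>k. real (k choose l) * (gaussian_moment (2 * l) *
        (2 ^ (k - l) * pochhammer (real (card I) / 2) (k - l)))) =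
      2 ^ k * pochhammer (real (card (insert i I)) / 2) k"
  proof -
    have "real (card (insert i I)) / 2 = 1 / 2 + real (card I) / 2"
      using insert.hyps by (simp add: add_divide_distrib)
    then have "2 ^ k * pochhammer (real (card (insert i I)) / 2) k =
        (\<Sum>l\<le>k. (2 ^ l * 2 ^ (k - l)) * (real (k choose l) * pochhammer (1 / 2) l * pochhammer (real (card I) / 2) (k - l)))"
      unfolding \<open>real (card (insert i I)) / 2 = 1 / 2 + real (card I) / 2\<close>
      by (simp add: pochhammer_binomial_sum sum_distrib_left flip: power_add)
    then show ?thesis
      by (simp add: gaussian_moment_def mult_ac)
  qed
  ultimately show ?case by simp
qed

section \<open>A symmetric tensor realizing the cubic form\<close>

text \<open>Up to normalization, \<open>a e\<^sub>0\<^sup>\<otimes>\<^sup>3\<close> plus the symmetrization of \<open>b e\<^sub>0 \<otimes> I\<close>.\<close>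

definition vector_tensor :: "nat \<Rightarrow> real \<Rightarrow> real \<Rightarrow> nat list \<Rightarrow> real" where
  "vector_tensor N a b = (\<lambda>is\<in>multi_indices 3 N.
     a * of_bool (is ! 0 = 0 \<and> is ! 1 = 0 \<and> is ! 2 = 0) +
     b * (of_bool (is ! 0 = 0 \<and> is ! 1 = is ! 2) + of_bool (is ! 1 = 0 \<and> is ! 0 = is ! 2) +
          of_bool (is ! 2 = 0 \<and> is ! 0 = is ! 1)))"

lemma multi_indices_3:
  "multi_indices 3 N = (\<lambda>(i, j, k). [i, j, k]) ` ({..<N} \<times> {..<N} \<times> {..<N})"
  by (auto simp: multi_indices_def numeral_3_eq_3 length_Suc_conv image_iff)

lemma mset_eq_3_cases:
  assumes "mset [i, j, k] = mset [l, m, n]"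
  shows "(l, m, n) \<in> {(i, j, k), (i, k, j), (j, i, k), (j, k, i), (k, i, j), (k, j, i)}"
proof -
  have pair: "(a = c \<and> b = d) \<or> (a = d \<and> b = c)" if "{#a, b#} = {#c, d#}" for a b c d :: 'a
    using that by (auto simp: add_eq_conv_diff)
  have "l \<in># mset [i, j, k]"
    by (simp only: assms) simp
  then consider "l = i" | "l = j" | "l = k"
    by auto
  then show ?thesis
  proof cases
    case 1
    then show ?thesis using assms pair[of j k m n] by auto
  next
    case 2
    then show ?thesis using assms pair[of i k m n] by (auto simp: add_mset_commute[of i])
  next
    case 3
    then have "{#i, j#} = {#m, n#}"
      using assms by (simp add: add_mset_commute[of _ k])
    with 3 show ?thesis using pair[of i j m n] by auto
  qed
qed

lemma vector_tensor_sym: "vector_tensor N a b \<in> sym_tensors 3 N"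
proof -
  define F :: "nat \<Rightarrow> nat \<Rightarrow> nat \<Rightarrow> real" where "F i j k =
     a * of_bool (i = 0 \<and> j = 0 \<and> k = 0) +
     b * (of_bool (i = 0 \<and> j = k) + of_bool (j = 0 \<and> i = k) + of_bool (k = 0 \<and> i = j))" for i j k
  have F: "vector_tensor N a b [i, j, k] = F i j k" if "[i, j, k] \<in> multi_indices 3 N" for i j k
    using that by (simp add: vector_tensor_def F_def)
  \<comment> \<open>The two adjacent transpositions generate all permutations of three
    indices.\<close>
  have swap: "F i j k = F j i k" "F i j k = F i k j" for i j k
    unfolding F_def by (simp_all add: conj_ac eq_commute[of j k] eq_commute[of i j] eq_commute[of i k])
  have "vector_tensor N a b is = vector_tensor N a b js"
    if ij: "is \<in> multi_indices 3 N" "js \<in> multi_indices 3 N" "mset is = mset js" for "is" js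
  proof -
    obtain i j k where "is": "is = [i, j, k]"
      using ij(1) by (auto simp: multi_indices_3)
    obtain l m n where js: "js = [l, m, n]"
      using ij(2) by (auto simp: multi_indices_3)
    have "(l, m, n) \<in> {(i, j, k), (i, k, j), (j, i, k), (j, k, i), (k, i, j), (k, j, i)}"
      using ij(3) unfolding "is" js by (rule mset_eq_3_cases)
    moreover have "F i k j = F i j k" "F j i k = F i j k" "F j k i = F i j k"
      "F k i j = F i j k" "F k j i = F i j k"
      using swap by metis+
    ultimately have "F i j k = F l m n"
      unfolding insert_iff empty_iff by (elim disjE Pair_inject FalseE) (simp_all only:)
    then show ?thesis
      using F ij(1,2) unfolding "is" js by simp
  qed
  moreover have "vector_tensor N a b \<in> multi_indices 3 N \<rightarrow>\<^sub>E UNIV"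
    by (simp add: vector_tensor_def)
  ultimately show ?thesis
    unfolding sym_tensors_def by blast
qed

lemma tensor_form_3:
  "tensor_form 3 N T g = (\<Sum>i<N. \<Sum>j<N. \<Sum>k<N. T [i, j, k] * (g i * g j * g k))"
proof -
  have "inj_on (\<lambda>(i, j, k). [i, j, k]) ({..<N} \<times> {..<N} \<times> {..<N})"
    by (auto simp: inj_on_def)
  then show ?thesis
    unfolding tensor_form_def multi_indices_3
    by (simp add: sum.reindex sum.cartesian_product)
       (simp add: case_prod_unfold numeral_3_eq_3 mult_ac)
qed

lemma tensor_form_vector_tensor:
  assumes "N > 0"
  shows "tensor_form 3 N (vector_tensor N a b) g =
    g 0 * ((a + 3 * b) * (g 0)\<^sup>2 + 3 * b * (\<Sum>i\<in>{1..<N}. (g i)\<^sup>2))"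
proof -
  have "tensor_form 3 N (vector_tensor N a b) g =
     (\<Sum>i<N. \<Sum>j<N. \<Sum>k<N. (a * of_bool (i = 0 \<and> j = 0 \<and> k = 0) +
     b * (of_bool (i = 0 \<and> j = k) + of_bool (j = 0 \<and> i = k) +
          of_bool (k = 0 \<and> i = j))) * (g i * g j * g k))"
    unfolding tensor_form_3
    by (intro sum.cong refl) (auto simp: vector_tensor_def multi_indices_3 image_iff)
  \<comment> \<open>Each indicator tests the innermost index first, so the sums collapse from the
    inside out as Kronecker deltas.\<close>
  also have "\<dots> = (\<Sum>i<N. \<Sum>j<N. \<Sum>k<N.
      (if k = 0 then if j = 0 then if i = 0 then a * (g 0 * g 0 * g 0) else 0 else 0 else 0) +
      (if k = j then if i = 0 then b * (g 0 * g j * g j) else 0 else 0) +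
      (if k = i then if j = 0 then b * (g 0 * g i * g i) else 0 else 0) +
      (if k = 0 then if j = i then b * (g 0 * g i * g i) else 0 else 0))"
    by (intro sum.cong refl) (simp add: algebra_simps)
  also have "\<dots> = a * (g 0 * g 0 * g 0) + 3 * (\<Sum>i<N. b * (g 0 * g i * g i))"
  proof -
    define c where "c = (\<lambda>i. b * (g 0 * g i * g i))"
    have "(\<Sum>j<N. if P then f j else 0) = (if P then \<Sum>j<N. f j else 0)" for P and f :: "nat \<Rightarrow> real"
      by simp
    then show ?thesis
      using assms unfolding c_def[symmetric, THEN fun_cong]
      by (simp add: sum.distrib flip: sum_distrib_left)
  qed
  also have "(\<Sum>i<N. b * (g 0 * g i * g i)) = b * g 0 * (\<Sum>i<N. (g i)\<^sup>2)"
    by (simp add: sum_distrib_left power2_eq_square mult_ac)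
  also have "(\<Sum>i<N. (g i)\<^sup>2) = (g 0)\<^sup>2 + (\<Sum>i\<in>{1..<N}. (g i)\<^sup>2)"
    using assms by (simp add: sum.atLeast_Suc_lessThan flip: atLeast0LessThan)
  finally show ?thesis
    by (simp add: algebra_simps power2_eq_square)
qed

section \<open>Mixed moments of the cubic form\<close>

lemma has_bochner_integral_std_gaussian_mult:
  "has_bochner_integral (std_gaussian (Suc n))
    (\<lambda>g. g 0 ^ c * (\<Sum>i\<in>{1..<Suc n}. (g i)\<^sup>2) ^ d)
    (gaussian_moment c * (2 ^ d * pochhammer (real n / 2) d))"
proof -
  have "{..<Suc n} = insert 0 {1..<Suc n}"
    by auto
  moreover have "has_bochner_integral (\<Pi>\<^sub>M i\<in>insert 0 {1..<Suc n}. std_normal_distribution)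
    (\<lambda>g. g 0 ^ c * (\<Sum>i\<in>{1..<Suc n}. (g i)\<^sup>2) ^ d)
    (gaussian_moment c * (2 ^ d * pochhammer (real n / 2) d))"
    using has_bochner_integral_gaussian_sumsq_power[of "{1..<Suc n}" d]
    by (intro has_bochner_integral_PiM_insert_mult[where f = "\<lambda>x. x ^ c"] prob_space_std_normal
        has_bochner_integral_std_normal_power)
       (auto simp del: sum.op_ivl_Suc intro!: borel_measurable_power borel_measurable_sum
          measurable_compose[OF measurable_component_singleton])
  ultimately show ?thesis
    by (simp add: std_gaussian_def)
qed

text \<open>With x = \<open>g 0\<close> and s the sum of the other n squares, this is the
  expectation of x^c s^d (x (p x^2 + q s))^j. Summand k stems from (p x^3)^k (q x s)^(j-k), hence
  the exponents j + 2k and j - k. Weights (c,d) = (0,0) serve the partition function; (2,0) and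
  (0,1) together give the squared norm x^2 + s in the numerator.\<close>

definition cubic_moment :: "real \<Rightarrow> real \<Rightarrow> nat \<Rightarrow> nat \<Rightarrow> nat \<Rightarrow> nat \<Rightarrow> real" where
  "cubic_moment p q n c d j = (\<Sum>k\<le>j. real (j choose k) * p ^ k * q ^ (j - k) *
     (gaussian_moment (c + j + 2 * k) * (2 ^ (d + (j - k)) * pochhammer (real n / 2) (d + (j - k)))))"

lemma has_bochner_integral_cubic_moment:
  "has_bochner_integral (std_gaussian (Suc n))
    (\<lambda>g. g 0 ^ c * (\<Sum>i\<in>{1..<Suc n}. (g i)\<^sup>2) ^ d *
      (g 0 * (p * (g 0)\<^sup>2 + q * (\<Sum>i\<in>{1..<Suc n}. (g i)\<^sup>2))) ^ j)
    (cubic_moment p q n c d j)"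
proof -
  have "x ^ c * s ^ d * (x * (p * x\<^sup>2 + q * s)) ^ j =
      (\<Sum>k\<le>j. real (j choose k) * p ^ k * q ^ (j - k) * (x ^ (c + j + 2 * k) * s ^ (d + (j - k))))"
    for x s :: real
    by (simp add: binomial_ring power_mult_distrib power_add power_mult power2_eq_square
        sum_distrib_left mult_ac del: Nat.add_diff_assoc)
  then show ?thesis
    unfolding cubic_moment_def
    by (simp only:) (intro has_bochner_integral_sum has_bochner_integral_mult_right
        has_bochner_integral_std_gaussian_mult)
qed

lemma
  fixes a b :: real and n :: nat
  defines "T \<equiv> vector_tensor (Suc n) a b"
  shows gurau_Z_vector_tensor: "fps_nth (gurau_Z 3 (Suc n) T) j =
      cubic_moment (a + 3 * b) (3 * b) n 0 0 j / (fact j * 3 ^ j)"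
    and gurau_numerator_vector_tensor: "fps_nth (gurau_numerator 3 (Suc n) T) j =
      (cubic_moment (a + 3 * b) (3 * b) n 2 0 j + cubic_moment (a + 3 * b) (3 * b) n 0 1 j) /
      (real (Suc n) * (fact j * 3 ^ j))"
proof -
  let ?s = "\<lambda>g. \<Sum>i\<in>{1..<Suc n}. (g i)\<^sup>2 :: real"
  have form: "tensor_form 3 (Suc n) T g = g 0 * ((a + 3 * b) * (g 0)\<^sup>2 + 3 * b * ?s g)" for g
    unfolding T_def by (rule tensor_form_vector_tensor) simp
  show "fps_nth (gurau_Z 3 (Suc n) T) j = cubic_moment (a + 3 * b) (3 * b) n 0 0 j / (fact j * 3 ^ j)"
    using has_bochner_integral_cubic_moment[of n 0 0 "a + 3 * b" "3 * b" j]
    unfolding form[symmetric]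
    by (simp add: gurau_Z_def has_bochner_integral_iff)
  have "has_bochner_integral (std_gaussian (Suc n))
      (\<lambda>g. (g 0 ^ 2 * ?s g ^ 0 * tensor_form 3 (Suc n) T g ^ j +
        g 0 ^ 0 * ?s g ^ 1 * tensor_form 3 (Suc n) T g ^ j) / real (Suc n))
      ((cubic_moment (a + 3 * b) (3 * b) n 2 0 j + cubic_moment (a + 3 * b) (3 * b) n 0 1 j) /
        real (Suc n))"
    unfolding form
    by (intro has_bochner_integral_divide has_bochner_integral_add has_bochner_integral_cubic_moment)
  moreover have "(g 0 ^ 2 * ?s g ^ 0 * tensor_form 3 (Suc n) T g ^ j +
        g 0 ^ 0 * ?s g ^ 1 * tensor_form 3 (Suc n) T g ^ j) / real (Suc n) =
      (\<Sum>i<Suc n. (g i)\<^sup>2) / real (Suc n) * tensor_form 3 (Suc n) T g ^ j" for g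
  proof -
    have "(\<Sum>i<Suc n. (g i)\<^sup>2) = (g 0)\<^sup>2 + ?s g"
      by (simp add: sum.atLeast_Suc_lessThan flip: atLeast0LessThan del: sum.op_ivl_Suc sum.lessThan_Suc)
    then show ?thesis
      by (simp add: algebra_simps del: sum.op_ivl_Suc sum.lessThan_Suc)
  qed
  ultimately show "fps_nth (gurau_numerator 3 (Suc n) T) j =
      (cubic_moment (a + 3 * b) (3 * b) n 2 0 j + cubic_moment (a + 3 * b) (3 * b) n 0 1 j) /
      (real (Suc n) * (fact j * 3 ^ j))"
    by (simp only: gurau_numerator_def fps_nth_Abs_fps has_bochner_integral_iff) simp
qed

section \<open>Exact evaluation of the fourth coefficient\<close>

text \<open>Comparing coefficients in f = h g is a triangular system for h; the vanishing of
  \<open>g\<close> at 1 and 3 removes the odd coefficients of h from the equations at 0, 2 and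
  4.\<close>

lemma fps_divide_nth_4:
  fixes f g :: "'a :: field fps"
  assumes "fps_nth g 0 = 1" "fps_nth g 1 = 0" "fps_nth g 3 = 0"
  shows "fps_nth (f / g) 4 = fps_nth f 4 - fps_nth f 2 * fps_nth g 2 -
    fps_nth f 0 * fps_nth g 4 + fps_nth f 0 * (fps_nth g 2)\<^sup>2"
proof -
  define h where "h = f / g"
  have "f = h * g"
    using assms(1) by (simp add: h_def fps_divide_unit mult.assoc inverse_mult_eq_1)
  then have "fps_nth f n = (\<Sum>i=0..n. fps_nth h i * fps_nth g (n - i))" for n
    by (simp add: fps_mult_nth)
  from this[of 0] this[of 2] this[of 4] show ?thesis
    unfolding h_def[symmetric] using assms
    by (simp add: numeral_eq_Suc algebra_simps)
qed

text \<open>The entries solve a + 3b = -15 and 3b = 6; b = 2 is the least positive integer for which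
  the ratio -5/2 leaves a integral.\<close>

lemma gurau_I_4_eq: "gurau_I 3 27 4 (vector_tensor 27 (-21) 2) = -13236"
proof -
  note Z = gurau_Z_vector_tensor[of 26 "-21" 2, simplified]
  note num = gurau_numerator_vector_tensor[of 26 "-21" 2, simplified]
  \<comment> \<open>The largest arguments occur at j = 4: moment 14 with weight x^2 and rising
    factorial 5 with weight s. The base 13 is n/2 for n = 26.\<close>
  have gm: "gaussian_moment 0 = 1" "gaussian_moment 2 = 1" "gaussian_moment 4 = 3"
    "gaussian_moment 6 = 15" "gaussian_moment 8 = 105" "gaussian_moment 10 = 945"
    "gaussian_moment 12 = 10395" "gaussian_moment 14 = 135135"
    by (simp_all add: gaussian_moment_def) (simp_all add: pochhammer_Suc eval_nat_numeral)
  have po: "pochhammer (13 :: real) 2 = 182" "pochhammer (13 :: real) 3 = 2730"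
    "pochhammer (13 :: real) 4 = 43680" "pochhammer (13 :: real) 5 = 742560"
    by (simp_all add: pochhammer_Suc eval_nat_numeral)
  have set: "{..2} = {0, 1, 2 :: nat}" "{..4} = {0, 1, 2, 3, 4 :: nat}"
    by auto
  have choose: "4 choose 2 = 6" "4 choose 3 = 4"
    by (simp_all add: eval_nat_numeral)
  have Z0: "fps_nth (gurau_Z 3 27 (vector_tensor 27 (-21) 2)) 0 = 1"
    by (simp add: Z cubic_moment_def gm)
  \<comment> \<open>The cubic form is odd in \<open>g 0\<close>, so its odd moments vanish.\<close>
  have Z_odd: "odd j \<Longrightarrow> fps_nth (gurau_Z 3 27 (vector_tensor 27 (-21) 2)) j = 0" for j
    by (simp add: Z cubic_moment_def gaussian_moment_def)
  \<comment> \<open>The prefactor \<open>fps_X\<close> shifts index 5 of the resolvent to index 4 of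
    the quotient; multiplying by N = 27 then yields -13236.\<close>
  have "fps_nth (gurau_numerator 3 27 (vector_tensor 27 (-21) 2) /
      gurau_Z 3 27 (vector_tensor 27 (-21) 2)) 4 = - 4412 / 9"
    by (subst fps_divide_nth_4[OF Z0 Z_odd Z_odd], simp, simp)
       (simp add: Z num cubic_moment_def gm po set choose fact_numeral
         gm(2)[unfolded numeral_2_eq_2] po(1)[unfolded numeral_2_eq_2] power2_eq_square)
  then show ?thesis
    by (simp add: gurau_I_def gurau_resolvent_def)
qed

theorem theorem1p1:
  shows "\<exists>T \<in> sym_tensors 3 27.
           gurau_I 3 27 4 T < 0 \<and>
           \<not> (\<exists>\<gamma> :: real measure. prob_space \<gamma> \<and> sets \<gamma> = sets borel \<and>
                (\<forall>k :: nat. has_bochner_integral \<gamma> (\<lambda>x. x ^ k) (1 / 27 * gurau_I 3 27 k T)))"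
proof (intro bexI[OF _ vector_tensor_sym] conjI)
  let ?T = "vector_tensor 27 (-21) 2"
  show "gurau_I 3 27 4 ?T < 0"
    by (simp add: gurau_I_4_eq)
  \<comment> \<open>An even moment cannot be negative, so k = 4 alone excludes every candidate
    measure.\<close>
  have "0 \<le> 1 / 27 * gurau_I 3 27 4 ?T"
    if "has_bochner_integral \<gamma> (\<lambda>x. x ^ 4) (1 / 27 * gurau_I 3 27 4 ?T)" for \<gamma> :: "real measure"
  proof -
    have "0 \<le> (LINT x|\<gamma>. x ^ 4)"
      by (intro integral_nonneg_AE) simp
    with that show ?thesis
      by (metis has_bochner_integral_integral_eq)
  qed
  with gurau_I_4_eq show "\<not> (\<exists>\<gamma> :: real measure. prob_space \<gamma> \<and> sets \<gamma> = sets borel \<and>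
      (\<forall>k :: nat. has_bochner_integral \<gamma> (\<lambda>x. x ^ k) (1 / 27 * gurau_I 3 27 k ?T)))"
    by fastforce
qed

end
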